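(* Let $0<a<1$ and let $\sigma_a(x)=\max\{x,ax\}$ be the leaky ReLU function, applied entrywise to matrices. For any $Z=Z_{\mathcal M}+Z_{\mathcal M^\perp}\in\mathbb{R}^{d\times n}$, let $H=\sigma_a(Z)=H_{\mathcal M}+H_{\mathcal M^\perp}$. Then $H_{\mathcal M^\perp}$ lies on the sphere (with respect to the Frobenius norm) centered at $(1+a)Z_{\mathcal M^\perp}/2$ with radius $$r_a:=\Big(\|(1-a)Z_{\mathcal M^\perp}/2\|_F^2-\langle H_{\mathcal M}-Z_{\mathcal M},H_{\mathcal M}-aZ_{\mathcal M}\rangle_F\Big)^{1/2}$$ (in particular the quantity under the root is nonnegative). In particular, $H_{\mathcal M^\perp}$ lies inside the closed ball centered at $(1+a)Z_{\mathcal M^\perp}/2$ with radius $\|(1-a)Z_{\mathcal M^\perp}/2\|_F$, and hence $a\|Z\|_{\mathcal M^\perp}\le\|H\|_{\mathcal M^\perp}\le\|Z\|_{\mathcal M^\perp}$.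
   Context: Let $G=(V,E)$ be an undirected graph with $n$ nodes, adjacency matrix $A\in\{0,1\}^{n\times n}$ and diagonal degree matrix $D$, $D_{ii}=\sum_j A_{ij}$. Put $\tilde A=A+I$, $\tilde D=D+I$, and let $\mathbf G=\tilde D^{-1/2}\tilde A\tilde D^{-1/2}$. Let $\mathcal M\subseteq\mathbb{R}^n$ be the eigenspace of $\mathbf G$ for its largest eigenvalue $1$, of dimension $m$ equal to the number of connected components of the graph; if $u_i\in\{0,1\}^n$ is the indicator vector of the $i$-th connected component, the entrywise nonnegative vectors $e_i=\tilde D^{1/2}u_i/\|\tilde D^{1/2}u_i\|$, $1\le i\le m$, form an orthonormal basis of $\mathcal M$. Extend to an orthonormal eigenbasis $e_1,\dots,e_n$ of $\mathbb{R}^n$ for $\mathbf G$. For $H\in\mathbb{R}^{d\times n}$ write $H_{\mathcal M}=\sum_{i=1}^m He_ie_i^\top$ and $H_{\mathcal M^\perp}=\sum_{i=m+1}^n He_ie_i^\top$, so $H=H_{\mathcal M}+H_{\mathcal M^\perp}$. $\langle A,B\rangle_F=\mathrm{Trace}(AB^\top)$ is the Frobenius inner product, $\|\cdot\|_F$ the Frobenius norm, and $\|H\|_{\mathcal M^\perp}:=\|H_{\mathcal M^\perp}\|_F$ (the distance of $H$ to $\mathbb{R}^d\otimes\mathcal M$, the space of matrices all of whose rows lie in $\mathcal M$). *)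

theory Defs
  imports "HOL-Analysis.Analysis"
begin

text \<open>
  The vertex set of the graph is the finite type \<open>'n\<close>, and the edges are a symmetric relation.
  Reflexive pairs are not excluded: a loop contributes \<open>1\<close> to the diagonal of the adjacency matrix
  and \<open>1\<close> to the degree, so that simple graphs are the special case of an irreflexive relation.
\<close>

definition adjacency_matrix :: "'n::finite rel \<Rightarrow> real ^ 'n ^ 'n" where
  "adjacency_matrix E = (\<chi> i j. if (i, j) \<in> E then 1 else 0)"

definition degree_matrix :: "'n::finite rel \<Rightarrow> real ^ 'n ^ 'n" where
  "degree_matrix E = (\<chi> i j. if i = j then \<Sum>k\<in>UNIV. adjacency_matrix E $ i $ k else 0)"

definition aug_adjacency :: "'n::finite rel \<Rightarrow> real ^ 'n ^ 'n" where
  "aug_adjacency E = adjacency_matrix E + mat 1"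

definition aug_degree :: "'n::finite rel \<Rightarrow> real ^ 'n ^ 'n" where
  "aug_degree E = degree_matrix E + mat 1"

text \<open>Real power of a diagonal matrix with positive diagonal; used for \<open>aug_degree E\<close> only.\<close>

definition diag_powr :: "real ^ 'n ^ 'n \<Rightarrow> real \<Rightarrow> real ^ 'n ^ 'n" where
  "diag_powr D p = (\<chi> i j. if i = j then (D $ i $ i) powr p else 0)"

definition conv_matrix :: "'n::finite rel \<Rightarrow> real ^ 'n ^ 'n" where
  "conv_matrix E =
    diag_powr (aug_degree E) (- 1 / 2) ** aug_adjacency E ** diag_powr (aug_degree E) (- 1 / 2)"

definition eigenspace :: "real ^ 'n ^ 'n \<Rightarrow> real \<Rightarrow> (real ^ 'n) set" where
  "eigenspace M c = {v. M *v v = c *\<^sub>R v}"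

text \<open>For symmetric \<open>E\<close>, the relation \<open>E\<^sup>*\<close> is the equivalence of being joined by a walk.\<close>

definition graph_components :: "'n rel \<Rightarrow> 'n set set" where
  "graph_components E = UNIV // E\<^sup>*"

definition component_vector :: "'n::finite rel \<Rightarrow> 'n set \<Rightarrow> real ^ 'n" where
  "component_vector E C =
    (let w = diag_powr (aug_degree E) (1 / 2) *v (\<chi> i. indicator C i) in (1 / norm w) *\<^sub>R w)"

definition orthonormal_eigenbasis :: "real ^ 'n ^ 'n \<Rightarrow> (nat \<Rightarrow> real ^ 'n) \<Rightarrow> bool" where
  "orthonormal_eigenbasis M e \<longleftrightarrow>
    (\<forall>i\<in>{1..CARD('n)}. \<forall>j\<in>{1..CARD('n)}. e i \<bullet> e j = (if i = j then 1 else 0)) \<and>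
    span (e ` {1..CARD('n)}) = UNIV \<and>
    (\<forall>i\<in>{1..CARD('n)}. \<exists>c. M *v e i = c *\<^sub>R e i)"

text \<open>
  An orthonormal eigenbasis \<open>e 1, \<dots>, e n\<close> whose first \<open>m\<close> members are the normalised vectors of the
  \<open>m\<close> connected components, listed without repetition in some order. By \<open>span_component_vectors\<close>
  below, these span the eigenspace of \<open>conv_matrix E\<close> for the eigenvalue \<open>1\<close>, which by
  \<open>eigenvalue_conv_matrix_le_1\<close> is the largest one.
\<close>

definition graph_eigenbasis :: "'n::finite rel \<Rightarrow> nat \<Rightarrow> (nat \<Rightarrow> real ^ 'n) \<Rightarrow> bool" where
  "graph_eigenbasis E m e \<longleftrightarrow>
    (\<exists>C. bij_betw C {1..m} (graph_components E) \<and> (\<forall>i\<in>{1..m}. e i = component_vector E (C i))) \<and>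
    orthonormal_eigenbasis (conv_matrix E) e"

definition part_M :: "nat \<Rightarrow> (nat \<Rightarrow> real ^ 'n) \<Rightarrow> real ^ 'n ^ 'd \<Rightarrow> real ^ 'n ^ 'd" where
  "part_M m e H =
    (\<Sum>i=1..m. H ** (columnvector (e i) :: real ^ 1 ^ 'n) ** (rowvector (e i) :: real ^ 'n ^ 1))"

definition part_Mperp :: "nat \<Rightarrow> (nat \<Rightarrow> real ^ 'n) \<Rightarrow> real ^ 'n ^ 'd \<Rightarrow> real ^ 'n ^ 'd" where
  "part_Mperp m e H =
    (\<Sum>i=m+1..CARD('n). H ** (columnvector (e i) :: real ^ 1 ^ 'n) ** (rowvector (e i) :: real ^ 'n ^ 1))"

text \<open>
  The norm of the type \<open>real ^ 'n ^ 'd\<close> is the Frobenius norm (\<open>norm_eq_frobenius\<close>), so that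
  \<open>norm\<close>, \<open>sphere\<close> and \<open>cball\<close> are the Frobenius ones.
\<close>

definition frobenius_inner :: "real ^ 'n ^ 'd \<Rightarrow> real ^ 'n ^ 'd \<Rightarrow> real" where
  "frobenius_inner A B = trace (A ** transpose B)"

definition norm_Mperp :: "nat \<Rightarrow> (nat \<Rightarrow> real ^ 'n) \<Rightarrow> real ^ 'n ^ 'd \<Rightarrow> real" where
  "norm_Mperp m e H = norm (part_Mperp m e H)"

definition leaky_relu :: "real \<Rightarrow> real \<Rightarrow> real" where
  "leaky_relu a x = max x (a * x)"

lemma frobenius_inner_eq_inner: "frobenius_inner A B = A \<bullet> B"
  by (simp add: frobenius_inner_def trace_def matrix_matrix_mult_def transpose_def inner_vec_def)

lemma norm_eq_frobenius: "norm A = sqrt (frobenius_inner A A)"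
  by (simp add: frobenius_inner_eq_inner norm_eq_sqrt_inner)

lemma aug_degree_pos: "0 < aug_degree E $ i $ i"
proof -
  have "0 \<le> (\<Sum>k\<in>UNIV. adjacency_matrix E $ i $ k)"
    by (intro sum_nonneg) (auto simp: adjacency_matrix_def)
  then show ?thesis
    by (simp add: aug_degree_def degree_matrix_def mat_def)
qed

lemma sum_aug_adjacency: "(\<Sum>j\<in>UNIV. aug_adjacency E $ i $ j) = aug_degree E $ i $ i"
  by (simp add: aug_adjacency_def aug_degree_def degree_matrix_def mat_def sum.distrib)

lemma aug_adjacency_sym: "sym E \<Longrightarrow> aug_adjacency E $ i $ j = aug_adjacency E $ j $ i"
  by (auto simp: aug_adjacency_def adjacency_matrix_def mat_def sym_def)

lemma diag_powr_mult_vec: "(diag_powr D p *v x) $ i = (D $ i $ i) powr p * x $ i"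
  by (simp add: diag_powr_def matrix_vector_mult_def if_distrib[of "\<lambda>y. y * _"] sum.delta cong: if_cong)

lemma diag_powr_cancel:
  "diag_powr (aug_degree E) (1 / 2) *v (diag_powr (aug_degree E) (- (1 / 2)) *v v) = v"
  "diag_powr (aug_degree E) (- (1 / 2)) *v (diag_powr (aug_degree E) (1 / 2) *v v) = v"
  using aug_degree_pos[of E]
  by (auto simp: vec_eq_iff diag_powr_mult_vec mult.assoc[symmetric] powr_add[symmetric]
      less_imp_neq[THEN not_sym])

lemma diag_powr_self_adjoint: "(diag_powr D p *v x) \<bullet> y = x \<bullet> (diag_powr D p *v y)"
  by (simp add: inner_vec_def diag_powr_mult_vec mult_ac)

lemma dirichlet_identity:
  fixes w :: "real ^ 'n::finite"
  assumes "sym E"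
  defines "v \<equiv> diag_powr (aug_degree E) (1 / 2) *v w"
  shows "v \<bullet> v - v \<bullet> (conv_matrix E *v v)
    = (\<Sum>i\<in>UNIV. \<Sum>j\<in>UNIV. aug_adjacency E $ i $ j * (w $ i - w $ j)\<^sup>2) / 2"
proof -
  let ?A = "\<lambda>i j. aug_adjacency E $ i $ j" and ?d = "\<lambda>i. aug_degree E $ i $ i"
  have "v \<bullet> (conv_matrix E *v v) = w \<bullet> (aug_adjacency E *v w)"
    by (simp add: v_def conv_matrix_def matrix_vector_mul_assoc[symmetric] diag_powr_self_adjoint
        diag_powr_cancel)
  also have "\<dots> = (\<Sum>i\<in>UNIV. \<Sum>j\<in>UNIV. ?A i j * (w $ i * w $ j))"
    by (simp add: inner_vec_def matrix_vector_mult_def sum_distrib_left mult_ac)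
  finally have 1: "v \<bullet> (conv_matrix E *v v) = \<dots>" .
  have 2: "v \<bullet> v = (\<Sum>i\<in>UNIV. ?d i * (w $ i)\<^sup>2)"
  proof -
    have *: "?d i powr (1 / 2) * ?d i powr (1 / 2) = ?d i" for i
      using aug_degree_pos[of E i] by (simp add: powr_add[symmetric])
    have "(?d i powr (1 / 2) * w $ i) * (?d i powr (1 / 2) * w $ i) = ?d i * (w $ i)\<^sup>2" for i
      by (metis * mult.assoc mult.left_commute power2_eq_square)
    then show ?thesis
      by (simp add: v_def inner_vec_def diag_powr_mult_vec)
  qed
  have 3: "(\<Sum>i\<in>UNIV. \<Sum>j\<in>UNIV. ?A i j * (w $ i)\<^sup>2) = (\<Sum>i\<in>UNIV. ?d i * (w $ i)\<^sup>2)"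
    by (simp add: sum_aug_adjacency sum_distrib_right[symmetric])
  have 4: "(\<Sum>i\<in>UNIV. \<Sum>j\<in>UNIV. ?A i j * (w $ j)\<^sup>2) = (\<Sum>i\<in>UNIV. ?d i * (w $ i)\<^sup>2)"
    using assms(1) by (subst sum.swap, subst aug_adjacency_sym) (simp_all add: 3)
  have "(\<Sum>i\<in>UNIV. \<Sum>j\<in>UNIV. ?A i j * (w $ i - w $ j)\<^sup>2)
     = (\<Sum>i\<in>UNIV. \<Sum>j\<in>UNIV. ?A i j * (w $ i)\<^sup>2 + ?A i j * (w $ j)\<^sup>2 - 2 * (?A i j * (w $ i * w $ j)))"
    by (intro sum.cong refl) (simp add: power2_eq_square algebra_simps)
  also have "\<dots> = 2 * (v \<bullet> v) - 2 * (v \<bullet> (conv_matrix E *v v))"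
    by (simp add: sum.distrib sum_subtractf 1 2 3 4 sum_distrib_left)
  finally show ?thesis by simp
qed

lemma eigenvalue_conv_matrix_le_1:
  fixes v :: "real ^ 'n::finite"
  assumes "sym E" "conv_matrix E *v v = c *\<^sub>R v" "v \<noteq> 0"
  shows "c \<le> 1"
proof -
  define w where "w = diag_powr (aug_degree E) (- (1 / 2)) *v v"
  have "0 \<le> (\<Sum>i\<in>UNIV. \<Sum>j\<in>UNIV. aug_adjacency E $ i $ j * (w $ i - w $ j)\<^sup>2) / 2"
    by (auto intro!: sum_nonneg simp: aug_adjacency_def adjacency_matrix_def mat_def)
  also have "\<dots> = v \<bullet> v - v \<bullet> (conv_matrix E *v v)"
    using dirichlet_identity[OF assms(1), of w] by (simp add: w_def diag_powr_cancel)
  also have "\<dots> = (1 - c) * (v \<bullet> v)"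
    by (simp add: assms(2) algebra_simps)
  finally have "0 \<le> (1 - c) * (v \<bullet> v)" .
  with assms(3) show ?thesis
    by (auto simp: zero_le_mult_iff dest: antisym[OF _ inner_ge_zero])
qed

lemma eigenspace_conv_matrix_iff:
  assumes "sym E"
  shows "diag_powr (aug_degree E) (1 / 2) *v w \<in> eigenspace (conv_matrix E) 1
    \<longleftrightarrow> (\<forall>i j. (i, j) \<in> E \<longrightarrow> w $ i = w $ j)" (is "?v \<in> _ \<longleftrightarrow> ?R")
proof
  let ?q = "\<lambda>i j. aug_adjacency E $ i $ j * (w $ i - w $ j)\<^sup>2"
  have q0: "0 \<le> ?q i j" for i j
    by (auto simp: aug_adjacency_def adjacency_matrix_def mat_def)
  assume "?v \<in> eigenspace (conv_matrix E) 1"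
  then have "(\<Sum>i\<in>UNIV. \<Sum>j\<in>UNIV. ?q i j) = 0"
    using dirichlet_identity[OF assms, of w] by (simp add: eigenspace_def)
  then have z: "?q i j = 0" for i j
    using q0 by (simp add: sum_nonneg_eq_0_iff sum_nonneg)
  show ?R
  proof (intro allI impI)
    fix i j assume "(i, j) \<in> E"
    then have "aug_adjacency E $ i $ j > 0"
      by (auto simp: aug_adjacency_def adjacency_matrix_def mat_def)
    with z[of i j] show "w $ i = w $ j" by auto
  qed
next
  assume R: ?R
  have "(aug_adjacency E *v w) $ i = aug_degree E $ i $ i * w $ i" for i
  proof -
    have "aug_adjacency E $ i $ j * w $ j = aug_adjacency E $ i $ j * w $ i" for j
      using R by (auto simp: aug_adjacency_def adjacency_matrix_def mat_def)
    then show ?thesis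
      unfolding matrix_vector_mult_def
      by (simp only: vec_lambda_beta) (simp add: sum_aug_adjacency[symmetric] sum_distrib_right cong: sum.cong)
  qed
  moreover have "d powr (- (1 / 2)) * (d * x) = d powr (1 / 2) * x" if "0 < d" for d x :: real
    using that powr_add[of d "- (1 / 2)" 1] by (simp add: mult.assoc[symmetric])
  ultimately have "diag_powr (aug_degree E) (- (1 / 2)) *v (aug_adjacency E *v w) = ?v"
    by (simp add: vec_eq_iff diag_powr_mult_vec aug_degree_pos)
  then show "?v \<in> eigenspace (conv_matrix E) 1"
    by (simp add: eigenspace_def conv_matrix_def matrix_vector_mul_assoc[symmetric] diag_powr_cancel)
qed

lemma equiv_walk: "sym E \<Longrightarrow> equiv UNIV (E\<^sup>*)"
  by (auto intro!: equivI simp: refl_rtrancl sym_rtrancl trans_rtrancl)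

lemma component_vector_nth:
  "component_vector E C $ i = (if i \<in> C then (aug_degree E $ i $ i) powr (1 / 2) else 0)
     / norm (diag_powr (aug_degree E) (1 / 2) *v (\<chi> i. indicator C i))"
  by (simp add: component_vector_def Let_def diag_powr_mult_vec)

lemma component_norm_pos:
  assumes "sym E" "C \<in> graph_components E"
  shows "0 < norm (diag_powr (aug_degree E) (1 / 2) *v (\<chi> i. indicator C i))"
proof -
  obtain i where "i \<in> C"
    using assms equiv_walk[OF assms(1)] unfolding graph_components_def
    by (metis all_not_in_conv in_quotient_imp_non_empty)
  then have "(diag_powr (aug_degree E) (1 / 2) *v (\<chi> i. indicator C i)) $ i \<noteq> 0"
    using aug_degree_pos[of E i] by (simp add: diag_powr_mult_vec)
  then show ?thesis by auto
qed

lemma component_vectors_orthonormal: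
  assumes "sym E" "C \<in> graph_components E" "C' \<in> graph_components E"
  shows "component_vector E C \<bullet> component_vector E C' = (if C = C' then 1 else 0)"
proof (cases "C = C'")
  case True
  have "norm (component_vector E C) = 1"
    using component_norm_pos[OF assms(1,2)] by (simp add: component_vector_def Let_def)
  with True show ?thesis by (simp add: dot_square_norm)
next
  case False
  then have "C \<inter> C' = {}"
    using quotient_disj[OF equiv_walk[OF assms(1)]] assms(2,3) by (auto simp: graph_components_def)
  then have "component_vector E C $ i * component_vector E C' $ i = 0" for i
    by (auto simp: component_vector_nth)
  with False show ?thesis by (simp only: inner_vec_def inner_real_def) simp
qed

lemma span_component_vectors:
  fixes E :: "'n::finite rel"
  assumes E: "sym E"
  shows "span (component_vector E ` graph_components E) = eigenspace (conv_matrix E) 1" (is "?S = ?M")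
proof
  have sub: "subspace ?M"
    by (auto simp: subspace_def eigenspace_def matrix_vector_right_distrib matrix_vector_mult_scaleR)
  have "component_vector E C \<in> ?M" if "C \<in> graph_components E" for C
  proof -
    have "i \<in> C \<longleftrightarrow> j \<in> C" if ij: "(i, j) \<in> E" for i j
    proof -
      have "(i, j) \<in> E\<^sup>*" "(j, i) \<in> E\<^sup>*" using ij E by (auto dest: symD)
      with \<open>C \<in> _\<close> show ?thesis
        unfolding graph_components_def quotient_def by (auto intro: rtrancl_trans)
    qed
    then have "diag_powr (aug_degree E) (1 / 2) *v (\<chi> i. indicator C i) \<in> ?M"
      unfolding eigenspace_conv_matrix_iff[OF E] by (auto simp: indicator_def)
    then show ?thesis
      using sub by (simp add: component_vector_def Let_def subspace_scale)
  qed
  then show "?S \<subseteq> ?M"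
    using sub by (intro span_minimal) auto
  show "?M \<subseteq> ?S"
  proof
    fix v assume v: "v \<in> ?M"
    define w where "w = diag_powr (aug_degree E) (- (1 / 2)) *v v"
    have vw: "v = diag_powr (aug_degree E) (1 / 2) *v w"
      by (simp add: w_def diag_powr_cancel)
    with v have edge: "(i, j) \<in> E \<Longrightarrow> w $ i = w $ j" for i j
      using eigenspace_conv_matrix_iff[OF E] by blast
    have walk: "w $ i = w $ j" if "(i, j) \<in> E\<^sup>*" for i j
      using that by induction (auto simp: edge)
    let ?r = "\<lambda>C. SOME i. i \<in> C"
    let ?u = "\<lambda>C. diag_powr (aug_degree E) (1 / 2) *v (\<chi> i. indicator C i) :: real ^ 'n"
    have "v = (\<Sum>C\<in>graph_components E. (w $ ?r C * norm (?u C)) *\<^sub>R component_vector E C)"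
    proof (subst vec_eq_iff, intro allI)
      fix i
      let ?C = "E\<^sup>* `` {i}"
      have C: "?C \<in> graph_components E" by (auto simp: graph_components_def quotient_def)
      have iff: "i \<in> C \<longleftrightarrow> C = ?C" if "C \<in> graph_components E" for C
        using that equiv_walk[OF E] unfolding graph_components_def
        by (metis Image_singleton_iff UNIV_I equiv_class_self quotientI rtrancl.rtrancl_refl
            quotient_disj disjoint_iff)
      have "?r ?C \<in> ?C" by (rule someI[of _ i]) auto
      then have r: "w $ ?r ?C = w $ i" using walk by force
      have "(\<Sum>C\<in>graph_components E. (w $ ?r C * norm (?u C)) *\<^sub>R component_vector E C) $ i
        = (\<Sum>C\<in>graph_components E. if C = ?C then (aug_degree E $ i $ i) powr (1 / 2) * w $ i else 0)"
        unfolding sum_component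
      proof (intro sum.cong refl)
        fix C assume "C \<in> graph_components E"
        with component_norm_pos[OF E this] iff[OF this] r
        show "((w $ ?r C * norm (?u C)) *\<^sub>R component_vector E C) $ i
          = (if C = ?C then (aug_degree E $ i $ i) powr (1 / 2) * w $ i else 0)"
          by (auto simp: component_vector_nth)
      qed
      also have "\<dots> = v $ i"
        using C by (simp add: vw diag_powr_mult_vec)
      finally show "v $ i = (\<Sum>C\<in>graph_components E. (w $ ?r C * norm (?u C)) *\<^sub>R component_vector E C) $ i" ..
    qed
    also have "\<dots> \<in> ?S"
      by (intro span_sum span_scale span_base) auto
    finally show "v \<in> ?S" .
  qed
qed

lemma card_graph_components_le: "card (graph_components (E :: 'n::finite rel)) \<le> CARD('n)"
proof -
  have "graph_components E = (\<lambda>i. E\<^sup>* `` {i}) ` UNIV"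
    by (auto simp: graph_components_def quotient_def)
  then show ?thesis by (simp add: card_image_le)
qed

lemma part_M_add_part_Mperp:
  fixes H :: "real ^ 'n ^ 'd"
  assumes "graph_eigenbasis E m e"
  shows "part_M m e H + part_Mperp m e H = H"
proof -
  let ?I = "{1..CARD('n)}"
  let ?P = "\<lambda>k. H ** (columnvector (e k) :: real ^ 1 ^ 'n) ** (rowvector (e k) :: real ^ 'n ^ 1)"
  have on: "\<And>i j. i \<in> ?I \<Longrightarrow> j \<in> ?I \<Longrightarrow> e i \<bullet> e j = (if i = j then 1 else 0)"
    and sp: "span (e ` ?I) = UNIV"
    using assms unfolding graph_eigenbasis_def orthonormal_eigenbasis_def by blast+
  have expand: "(\<Sum>k\<in>?I. (x \<bullet> e k) *\<^sub>R e k) = x" for x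
  proof -
    let ?y = "x - (\<Sum>k\<in>?I. (x \<bullet> e k) *\<^sub>R e k)"
    have "orthogonal ?y (e j)" if "j \<in> ?I" for j
    proof -
      have "(\<Sum>k\<in>?I. (x \<bullet> e k) * (e k \<bullet> e j)) = (\<Sum>k\<in>?I. if k = j then x \<bullet> e j else 0)"
        using on[OF _ that] by (intro sum.cong refl) simp
      then show ?thesis
        using that by (simp add: orthogonal_def inner_diff_left inner_sum_left)
    qed
    then have "orthogonal ?y y" if "y \<in> e ` ?I" for y
      using that by blast
    then have "orthogonal ?y ?y"
    proof (rule orthogonal_to_span[where S = "e ` ?I", rotated])
      show "?y \<in> span (e ` ?I)" unfolding sp by (rule UNIV_I)
    qed
    then have "?y = 0" by (simp only: orthogonal_self)
    then show ?thesis by (simp only: right_minus_eq)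
  qed
  have P: "?P k $ i $ j = (H $ i \<bullet> e k) * e k $ j" for k i j
    by (simp add: matrix_matrix_mult_def columnvector_def rowvector_def inner_vec_def)
  obtain C where "bij_betw C {1..m} (graph_components E)"
    using assms unfolding graph_eigenbasis_def by blast
  then have "m = card (graph_components E)"
    using bij_betw_same_card by fastforce
  then have I: "?I = {1..m} \<union> {m + 1..CARD('n)}"
    using card_graph_components_le[of E] by auto
  have "part_M m e H + part_Mperp m e H = (\<Sum>k\<in>?I. ?P k)"
    unfolding part_M_def part_Mperp_def I by (rule sum.union_disjoint[symmetric]) auto
  also have "\<dots> = H"
  proof (subst vec_eq_iff, subst vec_eq_iff, intro allI)
    fix i j
    show "(\<Sum>k\<in>?I. ?P k) $ i $ j = H $ i $ j"
      using arg_cong[OF expand[of "H $ i"], of "\<lambda>v. v $ j"] by (simp add: P)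
  qed
  finally show ?thesis .
qed

end

theory Submission
  imports Defs
begin

text \<open>
  Every entry \<open>h\<close> of \<open>H\<close> equals the corresponding entry \<open>z\<close> of \<open>Z\<close> or \<open>a z\<close>, and dominates both.
  Hence \<open>H - Z\<close> and \<open>H - a Z\<close> are orthogonal, and splitting both matrices along \<open>\<M>\<close> and its
  complement and completing the square in the complement gives the sphere. The radius is at most
  that of the ball because \<open>H - Z\<close> and \<open>H - a Z\<close> are entrywise nonnegative and so are
  \<open>e\<^sub>1, \<dots>, e\<^sub>m\<close>, which makes the inner product of the two components in \<open>\<M>\<close> nonnegative.
\<close>

text \<open>The two index sets share one orthonormal family over \<open>K\<close>, so that
  \<open>I = J\<close> gives Parseval's identity and disjoint \<open>I\<close>, \<open>J\<close>
  give orthogonality.\<close>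

lemma inner_sum_orthonormal:
  fixes e :: "'i \<Rightarrow> 'a::real_inner"
  assumes on: "\<And>i j. i \<in> K \<Longrightarrow> j \<in> K \<Longrightarrow> e i \<bullet> e j = (if i = j then 1 else 0)"
    and "finite K" "I \<subseteq> K" "J \<subseteq> K"
  shows "(\<Sum>i\<in>I. f i *\<^sub>R e i) \<bullet> (\<Sum>j\<in>J. g j *\<^sub>R e j) = (\<Sum>i\<in>I \<inter> J. f i * g i)"
proof -
  have fin: "finite I" "finite J"
    using assms(2-4) finite_subset by blast+
  have "(\<Sum>i\<in>I. f i *\<^sub>R e i) \<bullet> (\<Sum>j\<in>J. g j *\<^sub>R e j) = (\<Sum>i\<in>I. \<Sum>j\<in>J. f i * g j * (e i \<bullet> e j))"
    unfolding inner_sum_left unfolding inner_sum_right by (simp add: mult_ac)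
  also have "\<dots> = (\<Sum>i\<in>I. \<Sum>j\<in>J. if i = j then f i * g i else 0)"
  proof (intro sum.cong refl)
    fix i j assume "i \<in> I" "j \<in> J"
    then show "f i * g j * (e i \<bullet> e j) = (if i = j then f i * g i else 0)"
      using on[of i j] assms(3,4) by (simp add: subset_iff)
  qed
  also have "\<dots> = (\<Sum>i\<in>I. if i \<in> J then f i * g i else 0)"
    using fin by (simp add: sum.delta)
  also have "\<dots> = (\<Sum>i\<in>I \<inter> J. f i * g i)"
    using fin by (simp add: sum.inter_restrict)
  finally show ?thesis .
qed

text \<open>Right multiplication by the rank-one matrix of \<open>x\<close> acts on each row
  separately, which reduces statements about \<open>part_M\<close> and \<open>part_Mperp\<close> to
  vectors.\<close>

lemma row_projection:
  fixes H :: "real ^ 'n ^ 'd"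
  shows "(H ** (columnvector x :: real ^ 1 ^ 'n) ** (rowvector x :: real ^ 'n ^ 1)) $ r
    = (H $ r \<bullet> x) *\<^sub>R x"
  by (simp add: vec_eq_iff matrix_matrix_mult_def columnvector_def rowvector_def inner_vec_def)

lemma part_M_row: "part_M m e H $ r = (\<Sum>i=1..m. (H $ r \<bullet> e i) *\<^sub>R e i)"
  by (simp add: part_M_def row_projection)

lemma part_Mperp_row:
  fixes e :: "nat \<Rightarrow> real ^ 'n"
  shows "part_Mperp m e H $ r = (\<Sum>i=m+1..CARD('n). (H $ r \<bullet> e i) *\<^sub>R e i)"
  by (simp add: part_Mperp_def row_projection)

lemma linear_part_M: "linear (part_M m e)"
  by (rule linearI)
    \<comment> \<open>The instantiated \<open>vec_eq_iff\<close> splits matrices into rows but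
      leaves the rows whole, so that \<open>part_M_row\<close> applies.\<close>
    (simp_all add: vec_eq_iff[of "part_M m e _"] part_M_row inner_add_left scaleR_add_left sum.distrib
      scaleR_sum_right)

lemma linear_part_Mperp: "linear (part_Mperp m e)"
  by (rule linearI)
    (simp_all add: vec_eq_iff[of "part_Mperp m e _"] part_Mperp_row inner_add_left scaleR_add_left
      sum.distrib scaleR_sum_right)

lemma graph_eigenbasis_orthonormal:
  fixes e :: "nat \<Rightarrow> real ^ 'n"
  assumes "graph_eigenbasis E m e" "i \<in> {1..CARD('n)}" "j \<in> {1..CARD('n)}"
  shows "e i \<bullet> e j = (if i = j then 1 else 0)"
  using assms unfolding graph_eigenbasis_def orthonormal_eigenbasis_def by blast

text \<open>Each component contains a vertex. The bound puts \<open>{1..m}\<close> inside the index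
  range on which \<open>e\<close> is orthonormal.\<close>

lemma graph_eigenbasis_le_card:
  fixes e :: "nat \<Rightarrow> real ^ 'n"
  assumes "graph_eigenbasis E m e"
  shows "m \<le> CARD('n)"
proof -
  obtain C where "bij_betw C {1..m} (graph_components E)"
    using assms unfolding graph_eigenbasis_def by blast
  then have "m = card (graph_components E)"
    using bij_betw_same_card by fastforce
  then show ?thesis
    using card_graph_components_le[of E] by simp
qed

lemma graph_eigenbasis_nonneg:
  assumes "graph_eigenbasis E m e" "i \<in> {1..m}"
  shows "0 \<le> e i $ j"
proof -
  obtain C where "e i = component_vector E C"
    using assms unfolding graph_eigenbasis_def by blast
  then show ?thesis
    by (simp add: component_vector_nth)
qed

lemma inner_part_M_part_M:
  fixes e :: "nat \<Rightarrow> real ^ 'n"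
  assumes "graph_eigenbasis E m e"
  shows "part_M m e A \<bullet> part_M m e B = (\<Sum>r\<in>UNIV. \<Sum>i=1..m. (A $ r \<bullet> e i) * (B $ r \<bullet> e i))"
proof -
  have "part_M m e A $ r \<bullet> part_M m e B $ r = (\<Sum>i=1..m. (A $ r \<bullet> e i) * (B $ r \<bullet> e i))" for r
    unfolding part_M_row
    using inner_sum_orthonormal[OF graph_eigenbasis_orthonormal[OF assms],
        where K = "{1..CARD('n)}" and I = "{1..m}" and J = "{1..m}"
          and f = "\<lambda>i. A $ r \<bullet> e i" and g = "\<lambda>i. B $ r \<bullet> e i"]
      graph_eigenbasis_le_card[OF assms]
    by simp
  then show ?thesis
    by (simp add: inner_vec_def[of "part_M m e A"])
qed

lemma inner_part_M_part_Mperp: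
  fixes e :: "nat \<Rightarrow> real ^ 'n"
  assumes "graph_eigenbasis E m e"
  shows "part_M m e A \<bullet> part_Mperp m e B = 0"
proof -
  have "part_M m e A $ r \<bullet> part_Mperp m e B $ r = 0" for r
    unfolding part_M_row part_Mperp_row
    using inner_sum_orthonormal[OF graph_eigenbasis_orthonormal[OF assms],
        where K = "{1..CARD('n)}" and I = "{1..m}" and J = "{m+1..CARD('n)}"
          and f = "\<lambda>i. A $ r \<bullet> e i" and g = "\<lambda>i. B $ r \<bullet> e i"]
      graph_eigenbasis_le_card[OF assms]
    by simp
  then show ?thesis
    by (simp add: inner_vec_def[of "part_M m e A"])
qed

lemma inner_split:
  assumes "graph_eigenbasis E m e"
  shows "A \<bullet> B = part_M m e A \<bullet> part_M m e B + part_Mperp m e A \<bullet> part_Mperp m e B"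
proof -
  have "A \<bullet> B = (part_M m e A + part_Mperp m e A) \<bullet> (part_M m e B + part_Mperp m e B)"
    by (simp add: part_M_add_part_Mperp[OF assms])
  then show ?thesis
    using inner_part_M_part_Mperp[OF assms, of A B] inner_part_M_part_Mperp[OF assms, of B A]
    by (simp add: inner_add_left inner_add_right inner_commute)
qed

text \<open>The coefficients \<open>A $ r \<bullet> e i\<close> and
  \<open>B $ r \<bullet> e i\<close> with \<open>i \<le> m\<close> are sums of products of
  nonnegative entries.\<close>

lemma inner_part_M_nonneg:
  assumes "graph_eigenbasis E m e"
    and "\<And>r j. 0 \<le> A $ r $ j" "\<And>r j. 0 \<le> B $ r $ j"
  shows "0 \<le> part_M m e A \<bullet> part_M m e B"
  unfolding inner_part_M_part_M[OF assms(1)]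
  using assms(2,3) graph_eigenbasis_nonneg[OF assms(1)]
  by (intro sum_nonneg mult_nonneg_nonneg) (auto simp: inner_vec_def intro!: sum_nonneg)

text \<open>With centre \<open>c\<close> the midpoint of \<open>z\<close> and
  \<open>a *\<^sub>R z\<close>, and \<open>s\<close> half their difference, the inner product is
  that of \<open>h - c - s\<close> and \<open>h - c + s\<close>. It vanishes exactly on the sphere
  with diameter from \<open>a *\<^sub>R z\<close> to \<open>z\<close> (Thales).\<close>

lemma dist_midpoint_sq:
  fixes h z :: "'a::real_inner"
  shows "(dist (((1 + a) / 2) *\<^sub>R z) h)\<^sup>2 = (norm (((1 - a) / 2) *\<^sub>R z))\<^sup>2 + (h - z) \<bullet> (h - a *\<^sub>R z)"
  unfolding dist_norm power2_norm_eq_inner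
  by (simp add: inner_diff_left inner_diff_right inner_commute[of h z] field_simps)

text \<open>By the triangle inequality \<open>norm h\<close> differs from the norm of the centre by
  at most the radius, and \<open>(1 + a) / 2\<close> minus or plus \<open>(1 - a) / 2\<close> is
  \<open>a\<close> or \<open>1\<close>.\<close>

lemma norm_bounds_of_dist_midpoint:
  fixes h z :: "'a::real_normed_vector"
  assumes "0 \<le> a" "a \<le> 1"
    and "dist (((1 + a) / 2) *\<^sub>R z) h \<le> norm (((1 - a) / 2) *\<^sub>R z)"
  shows "a * norm z \<le> norm h" "norm h \<le> norm z"
proof -
  let ?c = "((1 + a) / 2) *\<^sub>R z"
  have c: "norm ?c = (1 + a) / 2 * norm z" and r: "norm (((1 - a) / 2) *\<^sub>R z) = (1 - a) / 2 * norm z"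
    using assms(1,2) by simp_all
  have "norm ?c - norm h \<le> (1 - a) / 2 * norm z" "norm h - norm ?c \<le> (1 - a) / 2 * norm z"
    using norm_triangle_ineq2[of ?c h] norm_triangle_ineq2[of h ?c] assms(3)
    unfolding r dist_norm norm_minus_commute[of h] by linarith+
  then show "a * norm z \<le> norm h" "norm h \<le> norm z"
    unfolding c by (simp_all add: field_simps)
qed

theorem proposition3p3:
  fixes E :: "'n::finite rel" and e :: "nat \<Rightarrow> real ^ 'n" and m :: nat
    and a :: real and Z H :: "real ^ 'n ^ 'd"
  assumes "sym E"
    and "graph_eigenbasis E m e"
    and "0 < a" and "a < 1"
    and "H = map_matrix (leaky_relu a) Z"
  shows
    "(let r2 = (norm (((1 - a) / 2) *\<^sub>R part_Mperp m e Z))\<^sup>2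
         - frobenius_inner (part_M m e H - part_M m e Z) (part_M m e H - a *\<^sub>R part_M m e Z)
      in 0 \<le> r2 \<and>
         part_Mperp m e H \<in> sphere (((1 + a) / 2) *\<^sub>R part_Mperp m e Z) (sqrt r2)) \<and>
     part_Mperp m e H \<in> cball (((1 + a) / 2) *\<^sub>R part_Mperp m e Z)
       (norm (((1 - a) / 2) *\<^sub>R part_Mperp m e Z)) \<and>
     a * norm_Mperp m e Z \<le> norm_Mperp m e H \<and>
     norm_Mperp m e H \<le> norm_Mperp m e Z"
proof -
  note g = \<open>graph_eigenbasis E m e\<close>
  let ?M = "part_M m e" and ?P = "part_Mperp m e"
  let ?c = "((1 + a) / 2) *\<^sub>R ?P Z" and ?r = "norm (((1 - a) / 2) *\<^sub>R ?P Z)"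
  \<comment> \<open>By linearity this is the term subtracted under the root; here the projections
    are applied to the entrywise nonnegative differences themselves.\<close>
  define q where "q = ?M (H - Z) \<bullet> ?M (H - a *\<^sub>R Z)"
  have H: "H $ r $ j = max (Z $ r $ j) (a * Z $ r $ j)" for r j
    using assms(5) by (simp add: map_matrix_def leaky_relu_def)
  have "(H - Z) $ r $ j * (H - a *\<^sub>R Z) $ r $ j = 0" for r j
    by (simp add: H max_def)
  then have orth: "(H - Z) \<bullet> (H - a *\<^sub>R Z) = 0"
    by (simp only: inner_vec_def inner_real_def sum.neutral_const)
  have q_nonneg: "0 \<le> q"
    unfolding q_def by (rule inner_part_M_nonneg[OF g]) (simp_all add: H)
  have M: "?M (H - Z) = ?M H - ?M Z" "?M (H - a *\<^sub>R Z) = ?M H - a *\<^sub>R ?M Z"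
    and P: "?P (H - Z) = ?P H - ?P Z" "?P (H - a *\<^sub>R Z) = ?P H - a *\<^sub>R ?P Z"
    by (simp_all add: linear_diff linear_scale linear_part_M linear_part_Mperp)
  \<comment> \<open>Since the full inner product is \<open>0\<close>, its component in the
    complement is \<open>- q\<close>.\<close>
  have d: "(dist ?c (?P H))\<^sup>2 = ?r\<^sup>2 - q"
    using orth inner_split[OF g, of "H - Z" "H - a *\<^sub>R Z"] dist_midpoint_sq[of a "?P Z" "?P H"]
    by (simp add: q_def P)
  \<comment> \<open>The radicand is nonnegative because it is a squared distance.\<close>
  then have r2: "0 \<le> ?r\<^sup>2 - q"
    by (metis zero_le_power2)
  have sph: "dist ?c (?P H) = sqrt (?r\<^sup>2 - q)"
    unfolding d[symmetric] by simp
  have ball: "dist ?c (?P H) \<le> ?r"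
    by (rule power2_le_imp_le) (use d q_nonneg in linarith, rule norm_ge_zero)
  have bounds: "a * norm (?P Z) \<le> norm (?P H)" "norm (?P H) \<le> norm (?P Z)"
    using norm_bounds_of_dist_midpoint[OF _ _ ball] assms(3,4) by simp_all
  show ?thesis
    unfolding Let_def frobenius_inner_eq_inner M[symmetric] q_def[symmetric] mem_sphere mem_cball
      norm_Mperp_def
    by (intro conjI r2 sph ball bounds)
qed

end
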